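(* Let $N\ge 1$, let $\mathbf{V}=(V_1,\dots,V_N)$ be an innately regular collection of closed linear subspaces of a real Hilbert space $H$, and let $\eta\in(0,1]$. Let $x_0\in H$ with $x_0\neq 0$, let $(i_n)_{n\ge 0}$ be any sequence in $\{1,\dots,N\}$ and $(\lambda_n)_{n\ge 0}$ any sequence in $[\eta,2-\eta]$, and let $(x_n)_{n\ge0}$ be defined by $x_{n+1}:=P_{i_n,\lambda_n}(x_n)$, $n\ge0$. Put $\delta_n:=\frac{\|x_{n+1}-x_n\|}{(2-\eta)\|x_0\|}$ and, for $\tau\in[0,1]$, let $S(\tau):=|\{n\ge 0:\delta_n\ge\tau\}|$. Then for all $\tau\in(0,1]$, $$S(\tau)\leq 3^{N-1}e^{N}\left(1+\frac{\log\tau}{N\log\beta_*}\right)^{N-1}\left(1+\frac{\log\tau}{N\log(1-\eta)}\right),$$ where, when $\eta=1$, the last factor is interpreted as $1$, and $\beta_*=\beta_*(\mathbf{V},\eta)$ is the constant defined in the context. In particular, $$S(\tau)<9^{N}\left(1+\frac{\log\tau}{N\log\beta_*}\right)^{N}.$$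
   Context: For $1\le i\le N$, $P_i$ denotes the orthogonal projection of $H$ onto $V_i$, and for $\lambda\in[0,2]$ its relaxation is $P_{i,\lambda}(x):=(1-\lambda)x+\lambda P_i(x)$. For a closed subspace $V$, $d(x,V)$ denotes the distance from $x$ to $V$. A finite collection $(W_1,\dots,W_m)$ of closed subspaces is regular if there is $\kappa<\infty$ with $d(x,W_1\cap\dots\cap W_m)\le\kappa\max_i d(x,W_i)$ for all $x\in H$; $\mathbf{V}$ is innately regular if every nonempty subcollection is regular. The angle $\varphi(V,W)\in[0,\frac{\pi}{2}]$ between closed subspaces $V,W$ is defined by $$\cos\varphi(V,W)=\sup\{|\langle v,w\rangle| : v\in V\cap(V\cap W)^\perp,\ w\in W\cap(V\cap W)^\perp,\ \|v\|\le1,\ \|w\|\le1\}$$ (so nested subspaces have angle $\pi/2$). For $I\subset[N]:=\{1,\dots,N\}$ let $V_I:=\bigcap_{i\in I}V_i$, with $V_\emptyset:=H$. It is known that innate regularity of $\mathbf{V}$ is equivalent to $\varphi(V_I,V_J)>0$ for all $I,J\subset[N]$. Define $$\kappa_*:=\max_{I,J\subset[N]}\frac{2}{\sin\varphi(V_I,V_J)},\qquad \varepsilon_*:=\tfrac12\kappa_*^{-N},\qquad \beta_*:=\left(1-\eta(2-\eta)\varepsilon_*^2\right)^{1/2}.$$ *)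

theory Defs
  imports "HOL-Analysis.Analysis"
begin

(* The library's closest_point is available only in Heine-Borel (finite-dimensional) spaces.
   For a closed subspace V of a Hilbert space the point p below exists and is unique. *)
definition orth_proj :: "'a::real_inner set \<Rightarrow> 'a \<Rightarrow> 'a" where
  "orth_proj V x = (THE p. p \<in> V \<and> x - p \<in> V\<^sup>\<bottom>)"

definition relaxed_proj :: "'a::real_inner set \<Rightarrow> real \<Rightarrow> 'a \<Rightarrow> 'a" where
  "relaxed_proj V lam x = (1 - lam) *\<^sub>R x + lam *\<^sub>R orth_proj V x"

(* A collection is a family V restricted to a finite nonempty index set I. *)
definition regular_collection :: "nat set \<Rightarrow> (nat \<Rightarrow> 'a::real_inner set) \<Rightarrow> bool" where
  "regular_collection I V \<longleftrightarrow>
     (\<exists>\<kappa>::real. \<forall>x. infdist x (\<Inter>i\<in>I. V i) \<le> \<kappa> * (MAX i\<in>I. infdist x (V i)))"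

definition innately_regular :: "nat \<Rightarrow> (nat \<Rightarrow> 'a::real_inner set) \<Rightarrow> bool" where
  "innately_regular N V \<longleftrightarrow> (\<forall>I\<subseteq>{1..N}. I \<noteq> {} \<longrightarrow> regular_collection I V)"

(* The supremum lies in [0,1] for subspaces V and W, so arccos gives the angle in [0,pi/2]. *)
definition subspace_angle :: "'a::real_inner set \<Rightarrow> 'a set \<Rightarrow> real" where
  "subspace_angle V W = arccos (Sup {\<bar>v \<bullet> w\<bar> | v w.
     v \<in> V \<inter> (V \<inter> W)\<^sup>\<bottom> \<and> w \<in> W \<inter> (V \<inter> W)\<^sup>\<bottom> \<and> norm v \<le> 1 \<and> norm w \<le> 1})"

(* The intersection over the empty index set is UNIV, the whole space. *)
definition subspace_Inter :: "(nat \<Rightarrow> 'a set) \<Rightarrow> nat set \<Rightarrow> 'a set" where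
  "subspace_Inter V I = (\<Inter>i\<in>I. V i)"

(* Under innate regularity all the angles are positive, so no division by zero occurs. *)
definition kappa_star :: "nat \<Rightarrow> (nat \<Rightarrow> 'a::real_inner set) \<Rightarrow> real" where
  "kappa_star N V =
     (MAX (I, J) \<in> Pow {1..N} \<times> Pow {1..N}.
        2 / sin (subspace_angle (subspace_Inter V I) (subspace_Inter V J)))"

definition eps_star :: "nat \<Rightarrow> (nat \<Rightarrow> 'a::real_inner set) \<Rightarrow> real" where
  "eps_star N V = 1/2 * kappa_star N V powi (- int N)"

definition beta_star :: "nat \<Rightarrow> (nat \<Rightarrow> 'a::real_inner set) \<Rightarrow> real \<Rightarrow> real" where
  "beta_star N V \<eta> = sqrt (1 - \<eta> * (2 - \<eta>) * (eps_star N V)\<^sup>2)"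

definition rel_step :: "real \<Rightarrow> (nat \<Rightarrow> 'a::real_inner) \<Rightarrow> nat \<Rightarrow> real" where
  "rel_step \<eta> x n = norm (x (Suc n) - x n) / ((2 - \<eta>) * norm (x 0))"

definition large_steps :: "real \<Rightarrow> (nat \<Rightarrow> 'a::real_inner) \<Rightarrow> real \<Rightarrow> nat set" where
  "large_steps \<eta> x \<tau> = {n. rel_step \<eta> x n \<ge> \<tau>}"

end

theory Submission
  imports Defs
begin

text \<open>Write \<open>V\<^sub>I\<close> for the intersection of the \<open>V\<^sub>i\<close> with \<open>i \<in> I\<close> and \<open>gap I x\<close> for the distance
  from \<open>x\<close> to \<open>V\<^sub>I\<close>. The length of a step is at most \<open>2 - \<eta>\<close> times the distance \<open>d\<^sub>n\<close> from
  \<open>x\<^sub>n\<close> to the subspace used, so it suffices to bound the moments \<open>\<Sum> d\<^sub>n powr \<gamma>\<close> for every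
  \<open>\<gamma> > 0\<close> and to apply Markov's inequality with the best exponent.

  A step that uses \<open>V\<^sub>j\<close> lowers the square of \<open>gap I\<close> by
  \<open>\<lambda> (2 - \<lambda>) d\<^sub>n\<^sup>2\<close>, the same amount for all \<open>I\<close> containing \<open>j\<close>
  (\<open>infdist_relaxed_proj\<close>). Suppose that a run uses exactly the indices in \<open>I\<close> but \<open>gap I\<close>
  stays above \<open>\<beta>\<close> times its initial value. Then each \<open>d\<^sub>n\<close> is small, and so is the total
  loss in the square of \<open>gap I\<close>. When a new index \<open>j\<close> appears after the set \<open>J\<close>, the point is close to \<open>V\<^sub>J\<close>
  (the gap to \<open>V\<^sub>J\<close> has only decreased so far) and close to \<open>V\<^sub>j\<close>, hence by regularity of the pair
  close to their intersection; by the equal losses, so is the starting point. Each new index costs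
  about one factor \<open>\<kappa>\<close>. Once all of \<open>I\<close> has appeared, the starting point would be closer to
  \<open>V\<^sub>I\<close> than its own gap allows (\<open>full_run_contracts\<close>).

  Now cut a run with indices in \<open>I\<close> into blocks, each ending as soon as all of \<open>I\<close>
  has been used. Up to its last step a block uses a proper subset of \<open>I\<close>, so if \<open>F\<close> bounds the
  moments for proper subsets then a block contributes at most \<open>F + 1\<close> times the
  power of the gap at its beginning, and these gaps decay geometrically from block to block. This gives the bound \<open>(F + 1) / (1 - \<beta> powr \<gamma>)\<close>
  for \<open>I\<close> (\<open>power_sum_recursion\<close>). For one subspace the contraction factor is \<open>1 - \<eta>\<close>,
  which is where the exceptional last factor of the theorem comes from. The choice
  \<open>\<gamma> = N / (- ln \<tau>)\<close> turns the moment bound into the stated one.\<close>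

section \<open>Orthogonal projections and relaxed steps\<close>

text \<open>The projection is the limit of a minimising sequence, which is Cauchy by the parallelogram
  law: the midpoint of two near-minimisers is no closer to \<open>x\<close> than the distance allows.\<close>

lemma exists_orthogonal_decomposition:
  fixes V :: "'a::{real_inner, complete_space} set"
  assumes V: "subspace V" "closed V"
  shows "\<exists>p\<in>V. x - p \<in> V\<^sup>\<bottom>"
proof -
  define d where "d = infdist x V"
  have ne: "V \<noteq> {}" using subspace_0[OF V(1)] by blast
  have d0: "0 \<le> d" by (simp add: d_def infdist_nonneg)
  have d_le: "d\<^sup>2 \<le> (norm (x - v))\<^sup>2" if "v \<in> V" for v
    using infdist_le[OF that, of x] d0 by (auto simp: d_def dist_norm intro!: power_mono)
  have "\<exists>v\<in>V. (norm (x - v))\<^sup>2 < d\<^sup>2 + 1 / real (Suc n)" for n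
  proof -
    have "d < sqrt (d\<^sup>2 + 1 / real (Suc n))" by (rule real_less_rsqrt) simp
    then have "(INF a\<in>V. dist x a) < sqrt (d\<^sup>2 + 1 / real (Suc n))"
      using ne by (simp add: d_def infdist_notempty)
    then obtain v where "v \<in> V" and v: "dist x v < sqrt (d\<^sup>2 + 1 / real (Suc n))"
      using ne by (subst (asm) cINF_less_iff) (auto intro!: bdd_belowI[of _ 0])
    have "(dist x v)\<^sup>2 < d\<^sup>2 + 1 / real (Suc n)"
      using power_strict_mono[OF v, of 2] by (simp del: of_nat_Suc)
    with \<open>v \<in> V\<close> show ?thesis by (auto simp: dist_norm)
  qed
  then obtain v where v: "\<And>n. v n \<in> V" "\<And>n. (norm (x - v n))\<^sup>2 < d\<^sup>2 + 1 / real (Suc n)"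
    by metis
  have parallelogram: "(norm (v m - v n))\<^sup>2 < 2 * (1 / real (Suc m)) + 2 * (1 / real (Suc n))" for m n
  proof -
    have "(1/2) *\<^sub>R (v m + v n) \<in> V" by (intro subspace_scale subspace_add V v)
    note d_le[OF this]
    moreover have "(norm (v m - v n))\<^sup>2 = 2 * (norm (x - v m))\<^sup>2 + 2 * (norm (x - v n))\<^sup>2
        - 4 * (norm (x - (1/2) *\<^sub>R (v m + v n)))\<^sup>2"
      by (simp add: power2_norm_eq_inner inner_simps inner_commute algebra_simps)
    ultimately show ?thesis using v(2)[of m] v(2)[of n] by linarith
  qed
  have "Cauchy v"
  proof (rule CauchyI)
    fix e :: real assume e: "0 < e"
    then obtain M where M: "4 / e\<^sup>2 < real M" using reals_Archimedean2 by blast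
    have "norm (v m - v n) < e" if "m \<ge> M" "n \<ge> M" for m n
    proof -
      have small: "2 * (1 / real (Suc k)) < e\<^sup>2 / 2" if "k \<ge> M" for k
      proof -
        have "4 / e\<^sup>2 < real (Suc k)" using M that by simp
        then show ?thesis using e by (simp add: field_simps del: of_nat_Suc)
      qed
      have "(norm (v m - v n))\<^sup>2 < e\<^sup>2"
        using parallelogram[of m n] small[OF that(1)] small[OF that(2)] by linarith
      then show ?thesis using e power_less_imp_less_base[of "norm (v m - v n)" 2 e] by simp
    qed
    then show "\<exists>M. \<forall>m\<ge>M. \<forall>n\<ge>M. norm (v m - v n) < e" by blast
  qed
  then obtain p where p: "v \<longlonglongrightarrow> p" using Cauchy_convergent convergent_def by blast
  have "p \<in> V" using closed_sequentially[OF V(2)] v(1) p by blast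
  have p_min: "(norm (x - p))\<^sup>2 \<le> d\<^sup>2"
  proof (rule LIMSEQ_le)
    show "(\<lambda>n. (norm (x - v n))\<^sup>2) \<longlonglongrightarrow> (norm (x - p))\<^sup>2" by (intro tendsto_intros p)
    show "(\<lambda>n. d\<^sup>2 + 1 / real (Suc n)) \<longlonglongrightarrow> d\<^sup>2"
      using LIMSEQ_Suc[OF tendsto_add[OF tendsto_const[of "d\<^sup>2"] lim_inverse_n']] by simp
    show "\<exists>N. \<forall>n\<ge>N. (norm (x - v n))\<^sup>2 \<le> d\<^sup>2 + 1 / real (Suc n)" using v(2) less_imp_le by blast
  qed
  have "inner y (x - p) = 0" if y: "y \<in> V" for y
  proof (cases "y = 0")
    case False
    \<comment> \<open>The step length \<open>t\<close> minimises the distance from \<open>x\<close> to the line through \<open>p\<close> along \<open>y\<close>.\<close>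
    define t where "t = inner y (x - p) / inner y y"
    have yy: "0 < inner y y" using False by simp
    have "p + t *\<^sub>R y \<in> V" by (intro subspace_add subspace_scale V y \<open>p \<in> V\<close>)
    then have "(norm (x - p))\<^sup>2 \<le> (norm (x - p - t *\<^sub>R y))\<^sup>2"
      using order_trans[OF p_min d_le] by (metis diff_diff_add)
    moreover have "(norm (x - p - t *\<^sub>R y))\<^sup>2
        = (norm (x - p))\<^sup>2 - 2 * t * inner y (x - p) + t * t * inner y y"
      unfolding power2_norm_eq_inner by (simp add: inner_diff inner_commute algebra_simps)
    moreover have "t * t * inner y y = t * inner y (x - p)" using yy by (simp add: t_def)
    ultimately have "t * inner y (x - p) \<le> 0" by simp
    then have "(inner y (x - p))\<^sup>2 / inner y y \<le> 0" by (simp add: t_def power2_eq_square)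
    then show ?thesis using yy by (simp add: divide_le_0_iff)
  qed simp
  then show ?thesis using \<open>p \<in> V\<close> by (auto simp: orthogonal_comp_def orthogonal_def)
qed

locale closed_subspace =
  fixes V :: "'a::{real_inner, complete_space} set"
  assumes subspace: "subspace V" and closed: "closed V"
begin

lemma orth_proj_eqI:
  assumes "p \<in> V" "x - p \<in> V\<^sup>\<bottom>"
  shows "orth_proj V x = p"
  unfolding orth_proj_def
proof (rule the_equality)
  fix q assume q: "q \<in> V \<and> x - q \<in> V\<^sup>\<bottom>"
  have "p - q \<in> V" using subspace_diff[OF subspace] assms(1) q by blast
  then have "inner (p - q) (x - p) = 0" "inner (p - q) (x - q) = 0"
    using assms(2) q by (auto simp: orthogonal_comp_def orthogonal_def)
  then have "inner (p - q) (p - q) = 0" by (simp add: inner_diff)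
  then show "q = p" by simp
qed (use assms in blast)

lemma orth_proj_in: "orth_proj V x \<in> V"
  and orth_proj_residual: "x - orth_proj V x \<in> V\<^sup>\<bottom>"
proof -
  obtain p where "p \<in> V" "x - p \<in> V\<^sup>\<bottom>"
    using exists_orthogonal_decomposition[OF subspace closed] by blast
  then show "orth_proj V x \<in> V" "x - orth_proj V x \<in> V\<^sup>\<bottom>" using orth_proj_eqI by auto
qed

lemma zero_in: "0 \<in> V"
  by (rule subspace_0[OF subspace])

lemma inner_residual: "y \<in> V \<Longrightarrow> inner y (x - orth_proj V x) = 0"
  using orth_proj_residual by (auto simp: orthogonal_comp_def orthogonal_def)

lemma inner_orth_proj: "y \<in> V \<Longrightarrow> inner y (orth_proj V x) = inner y x"
  using inner_residual[of y x] by (simp add: inner_diff_right)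

lemma norm_diff_orth_proj:
  assumes "y \<in> V"
  shows "(norm (x - y))\<^sup>2 = (norm (x - orth_proj V x))\<^sup>2 + (norm (orth_proj V x - y))\<^sup>2"
proof -
  have "orth_proj V x - y \<in> V" by (intro subspace_diff subspace orth_proj_in assms)
  from inner_residual[OF this] have "inner (x - orth_proj V x) (orth_proj V x - y) = 0"
    by (simp add: inner_commute)
  then show ?thesis
    using norm_add_Pythagorean[of "x - orth_proj V x" "orth_proj V x - y"]
    by (simp add: orthogonal_def)
qed

lemma infdist_eq_norm_residual: "infdist x V = norm (x - orth_proj V x)"
proof (rule antisym)
  show "infdist x V \<le> norm (x - orth_proj V x)"
    using infdist_le[OF orth_proj_in] by (simp add: dist_norm)
  have "norm (x - orth_proj V x) \<le> norm (x - y)" if "y \<in> V" for y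
    using norm_diff_orth_proj[OF that, of x] by - (rule power2_le_imp_le, auto)
  then show "norm (x - orth_proj V x) \<le> infdist x V"
    using orth_proj_in by (subst infdist_notempty) (auto simp: dist_norm intro!: cINF_greatest)
qed

lemma infdist_square: "(infdist x V)\<^sup>2 = (norm x)\<^sup>2 - (norm (orth_proj V x))\<^sup>2"
  using norm_diff_orth_proj[OF zero_in, of x] by (simp add: infdist_eq_norm_residual)

lemma orth_proj_orthogonal_translate:
  assumes "z \<in> V\<^sup>\<bottom>"
  shows "orth_proj V (x + z) = orth_proj V x"
proof (rule orth_proj_eqI[OF orth_proj_in])
  have "x - orth_proj V x + z \<in> V\<^sup>\<bottom>"
    by (intro subspace_add subspace_orthogonal_comp orth_proj_residual assms)
  then show "x + z - orth_proj V x \<in> V\<^sup>\<bottom>" by (simp add: algebra_simps)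
qed

end

text \<open>The step moves along \<open>V\<^sup>\<bottom> \<subseteq> U\<^sup>\<bottom>\<close>, so it fixes the projection to \<open>U\<close>. What it
  removes from the squared distance to \<open>U\<close> is what it removes from the squared norm, which does
  not involve \<open>U\<close>.\<close>

lemma infdist_relaxed_proj:
  fixes U V :: "'a::{real_inner, complete_space} set"
  assumes "closed_subspace U" "closed_subspace V" "U \<subseteq> V"
  shows "(infdist (relaxed_proj V lam x) U)\<^sup>2 = (infdist x U)\<^sup>2 - lam * (2 - lam) * (infdist x V)\<^sup>2"
proof -
  interpret U: closed_subspace U by fact
  interpret V: closed_subspace V by fact
  define z where "z = x - orth_proj V x"
  have step: "relaxed_proj V lam x = x + (- lam) *\<^sub>R z"
    by (simp add: relaxed_proj_def z_def algebra_simps)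
  have "(- lam) *\<^sub>R z \<in> U\<^sup>\<bottom>"
    unfolding z_def using orthogonal_comp_anti_mono[OF assms(3)] V.orth_proj_residual[of x]
    by (intro subspace_scale subspace_orthogonal_comp) auto
  then have "orth_proj U (relaxed_proj V lam x) = orth_proj U x"
    unfolding step by (rule U.orth_proj_orthogonal_translate)
  moreover have "(norm (x + (- lam) *\<^sub>R z))\<^sup>2 = (norm x)\<^sup>2 - 2 * lam * inner x z + lam\<^sup>2 * (norm z)\<^sup>2"
    unfolding power2_norm_eq_inner
    by (simp add: inner_add inner_commute power2_eq_square algebra_simps)
  moreover have "inner x z = (norm z)\<^sup>2"
    using V.inner_residual[OF V.orth_proj_in, of x x]
    by (simp add: z_def power2_norm_eq_inner inner_diff)
  ultimately show ?thesis
    unfolding U.infdist_square[of "relaxed_proj V lam x"] U.infdist_square[of x]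
    by (simp add: step V.infdist_eq_norm_residual z_def[symmetric] power2_eq_square algebra_simps)
qed

lemma norm_relaxed_step:
  assumes "closed_subspace V"
  shows "norm (relaxed_proj V lam x - x) = \<bar>lam\<bar> * infdist x V"
proof -
  have "relaxed_proj V lam x - x = (- lam) *\<^sub>R (x - orth_proj V x)"
    by (simp add: relaxed_proj_def algebra_simps)
  then show ?thesis using closed_subspace.infdist_eq_norm_residual[OF assms] by simp
qed

lemma closed_subspace_Inter:
  assumes "\<And>j. j \<in> I \<Longrightarrow> closed_subspace (V j)"
  shows "closed_subspace (subspace_Inter V I)"
proof
  show "subspace (subspace_Inter V I)"
    using assms closed_subspace.subspace unfolding subspace_Inter_def
    by (intro subspace_Inter) blast
  show "closed (subspace_Inter V I)"
    using assms closed_subspace.closed unfolding subspace_Inter_def by (intro closed_INT) blast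
qed

section \<open>Angles and regularity of pairs of subspaces\<close>

definition friedrichs_cosine :: "'a::real_inner set \<Rightarrow> 'a set \<Rightarrow> real" where
  "friedrichs_cosine V W = Sup {\<bar>v \<bullet> w\<bar> | v w.
     v \<in> V \<inter> (V \<inter> W)\<^sup>\<bottom> \<and> w \<in> W \<inter> (V \<inter> W)\<^sup>\<bottom> \<and> norm v \<le> 1 \<and> norm w \<le> 1}"

lemma subspace_angle_arccos: "subspace_angle V W = arccos (friedrichs_cosine V W)"
  by (simp add: subspace_angle_def friedrichs_cosine_def)

context
  fixes V W :: "'a::{real_inner, complete_space} set"
  assumes V: "closed_subspace V" and W: "closed_subspace W"
begin

interpretation V: closed_subspace V by (rule V)
interpretation W: closed_subspace W by (rule W)
interpretation VW: closed_subspace "V \<inter> W"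
  by (simp add: closed_subspace_def subspace_inter V.subspace W.subspace closed_Int V.closed W.closed)

lemma cosine_upper:
  assumes "v \<in> V \<inter> (V \<inter> W)\<^sup>\<bottom>" "w \<in> W \<inter> (V \<inter> W)\<^sup>\<bottom>" "norm v \<le> 1" "norm w \<le> 1"
  shows "\<bar>inner v w\<bar> \<le> friedrichs_cosine V W"
  unfolding friedrichs_cosine_def
proof (rule cSup_upper)
  have "\<bar>inner v w\<bar> \<le> 1" if "norm v \<le> 1" "norm w \<le> 1" for v w :: 'a
    using Cauchy_Schwarz_ineq2[of v w] mult_mono[OF that] by simp
  then show "bdd_above {\<bar>v \<bullet> w\<bar> | v w. v \<in> V \<inter> (V \<inter> W)\<^sup>\<bottom> \<and> w \<in> W \<inter> (V \<inter> W)\<^sup>\<bottom>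
      \<and> norm v \<le> 1 \<and> norm w \<le> 1}"
    by (intro bdd_aboveI[of _ 1]) auto
qed (use assms in blast)

lemma cosine_least:
  assumes "\<And>v w. v \<in> V \<inter> (V \<inter> W)\<^sup>\<bottom> \<Longrightarrow> w \<in> W \<inter> (V \<inter> W)\<^sup>\<bottom> \<Longrightarrow> norm v \<le> 1 \<Longrightarrow> norm w \<le> 1
      \<Longrightarrow> \<bar>inner v w\<bar> \<le> c"
  shows "friedrichs_cosine V W \<le> c"
  unfolding friedrichs_cosine_def
proof (rule cSup_least)
  have "0 \<in> V \<inter> (V \<inter> W)\<^sup>\<bottom>" "0 \<in> W \<inter> (V \<inter> W)\<^sup>\<bottom>"
    using V.subspace W.subspace by (auto simp: subspace_0 subspace_orthogonal_comp)
  then have "\<bar>0 \<bullet> (0::'a)\<bar> \<in> {\<bar>v \<bullet> w\<bar> | v w. v \<in> V \<inter> (V \<inter> W)\<^sup>\<bottom> \<and> w \<in> W \<inter> (V \<inter> W)\<^sup>\<bottom>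
      \<and> norm v \<le> 1 \<and> norm w \<le> 1}"
    by (intro CollectI exI[of _ 0]) simp
  then show "{\<bar>v \<bullet> w\<bar> | v w. v \<in> V \<inter> (V \<inter> W)\<^sup>\<bottom> \<and> w \<in> W \<inter> (V \<inter> W)\<^sup>\<bottom>
      \<and> norm v \<le> 1 \<and> norm w \<le> 1} \<noteq> {}" by blast
qed (use assms in blast)

lemma cosine_nonneg: "0 \<le> friedrichs_cosine V W"
  using cosine_upper[of 0 0] V.subspace W.subspace
  by (simp add: subspace_0 subspace_orthogonal_comp)

lemma inner_le_cosine:
  assumes v: "v \<in> V \<inter> (V \<inter> W)\<^sup>\<bottom>" and w: "w \<in> W \<inter> (V \<inter> W)\<^sup>\<bottom>"
  shows "\<bar>inner v w\<bar> \<le> friedrichs_cosine V W * (norm v * norm w)"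
proof (cases "v = 0 \<or> w = 0")
  case False
  have "\<bar>inner (v /\<^sub>R norm v) (w /\<^sub>R norm w)\<bar> \<le> friedrichs_cosine V W"
  proof (rule cosine_upper)
    show "v /\<^sub>R norm v \<in> V \<inter> (V \<inter> W)\<^sup>\<bottom>" "w /\<^sub>R norm w \<in> W \<inter> (V \<inter> W)\<^sup>\<bottom>"
      using v w by (simp_all add: subspace_scale V.subspace W.subspace subspace_orthogonal_comp)
  qed (use False in simp_all)
  then show ?thesis using False by (simp add: abs_mult field_simps)
qed auto

text \<open>Linear regularity of a pair forces a positive angle: if a unit vector \<open>v \<in> V\<close> is
  orthogonal to \<open>V \<inter> W\<close>, its distance to \<open>W\<close> is at least \<open>1/k\<close>, so its projection
  to \<open>W\<close> has norm at most \<open>sqrt (1 - 1/k\<^sup>2)\<close>. That projection alone enters \<open>\<langle>v, w\<rangle>\<close> for \<open>w \<in> W\<close>.\<close>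

lemma sin_angle_pos_of_regular:
  assumes regular: "\<And>x. infdist x (V \<inter> W) \<le> k * max (infdist x V) (infdist x W)"
  shows "0 < sin (subspace_angle V W)"
proof -
  \<comment> \<open>Enlarging the constant to at least \<open>1\<close> keeps the square root real.\<close>
  define K where "K = max k 1"
  define c where "c = sqrt (1 - 1 / K\<^sup>2)"
  have K: "1 \<le> K" "k \<le> K" by (auto simp: K_def)
  have K2: "1 \<le> K\<^sup>2" using K(1) by simp
  then have "1 - 1 / K\<^sup>2 < 1" using K(1) by simp
  then have "c < 1" by (simp add: c_def)
  have "friedrichs_cosine V W \<le> c"
  proof (rule cosine_least)
    fix v w assume v: "v \<in> V \<inter> (V \<inter> W)\<^sup>\<bottom>" and w: "w \<in> W \<inter> (V \<inter> W)\<^sup>\<bottom>"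
      and nv: "norm v \<le> 1" and nw: "norm w \<le> 1"
    have "orth_proj (V \<inter> W) v = 0"
      using v VW.zero_in by (intro VW.orth_proj_eqI) auto
    then have "norm v \<le> k * max (infdist v V) (infdist v W)"
      using regular[of v] VW.infdist_eq_norm_residual[of v] by simp
    also have "\<dots> = k * infdist v W" using v by (simp add: infdist_nonneg max_def)
    also have "\<dots> \<le> K * infdist v W" by (intro mult_right_mono K infdist_nonneg)
    finally have "(norm v)\<^sup>2 \<le> (K * infdist v W)\<^sup>2" by (simp add: power_mono)
    then have "(norm v)\<^sup>2 \<le> K\<^sup>2 * ((norm v)\<^sup>2 - (norm (orth_proj W v))\<^sup>2)"
      by (simp add: power_mult_distrib W.infdist_square)
    then have "(norm (orth_proj W v))\<^sup>2 \<le> (1 - 1 / K\<^sup>2) * (norm v)\<^sup>2"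
      using K(1) by (simp add: field_simps)
    also have "\<dots> \<le> 1 - 1 / K\<^sup>2"
      using K K2 nv by (intro mult_left_le) (auto simp: power_le_one divide_le_eq)
    finally have "norm (orth_proj W v) \<le> c" unfolding c_def by (rule real_le_rsqrt)
    moreover have "\<bar>inner v w\<bar> \<le> norm (orth_proj W v) * norm w"
      using W.inner_orth_proj[of w v] w Cauchy_Schwarz_ineq2[of "orth_proj W v" w]
      by (simp add: inner_commute)
    moreover have "norm (orth_proj W v) * norm w \<le> norm (orth_proj W v)"
      using nw by (intro mult_left_le) auto
    ultimately show "\<bar>inner v w\<bar> \<le> c" by linarith
  qed
  then have "friedrichs_cosine V W < 1" using \<open>c < 1\<close> by linarith
  moreover have "(friedrichs_cosine V W)\<^sup>2 < 1"
    using calculation cosine_nonneg by (simp add: abs_square_less_1)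
  ultimately show ?thesis
    using cosine_nonneg by (simp add: subspace_angle_arccos sin_arccos)
qed

text \<open>Conversely a positive angle gives regularity with an explicit constant. After
  subtracting the projection to \<open>V \<inter> W\<close>, let \<open>v\<close>, \<open>w\<close> be the projections of \<open>u\<close> and
  \<open>A = |v|\<^sup>2 + |w|\<^sup>2 = \<langle>u, v + w\<rangle>\<close>. The angle gives \<open>|v + w|\<^sup>2 \<le> (1 + c) A\<close>, so
  \<open>A \<le> (1 + c) |u|\<^sup>2\<close>, and \<open>A\<close> is \<open>2 |u|\<^sup>2\<close> minus the two squared distances.\<close>

lemma regular_of_sin_angle_pos:
  assumes pos: "0 < sin (subspace_angle V W)"
  shows "infdist x (V \<inter> W) \<le> 2 / sin (subspace_angle V W) * max (infdist x V) (infdist x W)"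
proof -
  define c where "c = friedrichs_cosine V W"
  define D where "D = max (infdist x V) (infdist x W)"
  have D0: "0 \<le> D" by (auto simp: D_def infdist_nonneg le_max_iff_disj)
  have c0: "0 \<le> c" by (simp add: c_def cosine_nonneg)
  have c1: "c \<le> 1" unfolding c_def
  proof (rule cosine_least)
    fix v w :: 'a assume "norm v \<le> 1" "norm w \<le> 1"
    then show "\<bar>inner v w\<bar> \<le> 1"
      using Cauchy_Schwarz_ineq2[of v w] mult_mono[of "norm v" 1 "norm w" 1] by simp
  qed
  have s: "sin (subspace_angle V W) = sqrt (1 - c\<^sup>2)"
    using c0 c1 by (simp add: subspace_angle_arccos c_def[symmetric] sin_arccos)
  then have s2: "(sin (subspace_angle V W))\<^sup>2 = 1 - c\<^sup>2"
    using c0 c1 by (simp add: abs_square_le_1)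
  define p where "p = orth_proj (V \<inter> W) x"
  define u where "u = x - p"
  define v where "v = orth_proj V x - p"
  define w where "w = orth_proj W x - p"
  have p: "p \<in> V" "p \<in> W" using VW.orth_proj_in[of x] by (auto simp: p_def)
  have u: "u \<in> (V \<inter> W)\<^sup>\<bottom>" by (simp add: u_def p_def VW.orth_proj_residual)
  have rV: "x - orth_proj V x \<in> (V \<inter> W)\<^sup>\<bottom>" and rW: "x - orth_proj W x \<in> (V \<inter> W)\<^sup>\<bottom>"
    using V.orth_proj_residual W.orth_proj_residual
      orthogonal_comp_anti_mono[of "V \<inter> W" V] orthogonal_comp_anti_mono[of "V \<inter> W" W] by blast+
  have "v = u - (x - orth_proj V x)" "w = u - (x - orth_proj W x)"
    by (simp_all add: u_def v_def w_def)
  then have "v \<in> (V \<inter> W)\<^sup>\<bottom>" "w \<in> (V \<inter> W)\<^sup>\<bottom>"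
    using subspace_diff[OF subspace_orthogonal_comp u] rV rW by simp_all
  moreover have "v \<in> V" "w \<in> W"
    using p V.orth_proj_in W.orth_proj_in
    by (auto simp: v_def w_def intro!: subspace_diff V.subspace W.subspace)
  ultimately have v: "v \<in> V \<inter> (V \<inter> W)\<^sup>\<bottom>" and w: "w \<in> W \<inter> (V \<inter> W)\<^sup>\<bottom>" by simp_all
  have dV: "(infdist x V)\<^sup>2 = (norm u)\<^sup>2 - (norm v)\<^sup>2"
    and dW: "(infdist x W)\<^sup>2 = (norm u)\<^sup>2 - (norm w)\<^sup>2"
    using V.norm_diff_orth_proj[OF p(1), of x] W.norm_diff_orth_proj[OF p(2), of x]
    by (simp_all add: V.infdist_eq_norm_residual W.infdist_eq_norm_residual u_def v_def w_def)
  have "inner u v = (norm v)\<^sup>2"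
    using V.inner_residual[of v x] v
    by (simp add: u_def power2_norm_eq_inner v_def inner_diff inner_commute)
  moreover have "inner u w = (norm w)\<^sup>2"
    using W.inner_residual[of w x] w
    by (simp add: u_def power2_norm_eq_inner w_def inner_diff inner_commute)
  moreover define A where "A = (norm v)\<^sup>2 + (norm w)\<^sup>2"
  ultimately have uvw: "inner u (v + w) = A" by (simp add: inner_add_right)
  have A0: "0 \<le> A" by (simp add: A_def)
  have "(norm (v + w))\<^sup>2 = A + 2 * inner v w"
    unfolding A_def power2_norm_eq_inner by (simp add: inner_add inner_commute)
  also have "\<dots> \<le> A + c * (2 * norm v * norm w)"
    using inner_le_cosine[OF v w] by (simp add: c_def)
  also have "\<dots> \<le> A + c * A"
    using c0 sum_squares_bound[of "norm v" "norm w"]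
    by (intro add_left_mono mult_left_mono) (auto simp: A_def)
  finally have vw: "(norm (v + w))\<^sup>2 \<le> (1 + c) * A" by (simp add: algebra_simps)
  have "A\<^sup>2 \<le> (norm u)\<^sup>2 * (norm (v + w))\<^sup>2"
    using Cauchy_Schwarz_ineq[of u "v + w"] by (simp add: uvw power2_norm_eq_inner)
  also have "\<dots> \<le> (norm u)\<^sup>2 * ((1 + c) * A)" by (intro mult_left_mono vw) simp
  finally have "A * A \<le> ((1 + c) * (norm u)\<^sup>2) * A" by (simp add: power2_eq_square mult_ac)
  then have "A \<le> (1 + c) * (norm u)\<^sup>2"
    using A0 c0 by (cases "A = 0") (auto simp: mult_le_cancel_right)
  then have "(1 - c) * (norm u)\<^sup>2 \<le> (infdist x V)\<^sup>2 + (infdist x W)\<^sup>2"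
    unfolding dV dW A_def by (simp add: algebra_simps)
  also have "\<dots> \<le> 2 * D\<^sup>2"
    using power_mono[of "infdist x V" D 2] power_mono[of "infdist x W" D 2]
    by (simp add: D_def infdist_nonneg)
  finally have "(1 + c) * ((1 - c) * (norm u)\<^sup>2) \<le> (1 + c) * (2 * D\<^sup>2)"
    using c0 by (intro mult_left_mono) auto
  also have "\<dots> \<le> 2 * (2 * D\<^sup>2)" using c1 by (intro mult_right_mono) auto
  finally have "(sin (subspace_angle V W) * norm u)\<^sup>2 \<le> (2 * D)\<^sup>2"
    unfolding power_mult_distrib s2 by (simp add: power2_eq_square algebra_simps)
  then have "sin (subspace_angle V W) * norm u \<le> 2 * D"
    using D0 by - (rule power2_le_imp_le, auto)
  then have "norm u \<le> 2 / sin (subspace_angle V W) * D" using pos by (simp add: field_simps)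
  then show ?thesis by (simp add: VW.infdist_eq_norm_residual u_def p_def D_def)
qed

end

section \<open>Contraction along runs that visit all subspaces\<close>

text \<open>Only the first \<open>M\<close> steps are constrained, so that initial segments and shifts of a run are
  again runs, with sequences that stay total.\<close>

definition relaxed_run ::
  "(nat \<Rightarrow> 'a::real_inner set) \<Rightarrow> real \<Rightarrow> nat set \<Rightarrow> nat \<Rightarrow> (nat \<Rightarrow> 'a) \<Rightarrow> (nat \<Rightarrow> nat) \<Rightarrow> (nat \<Rightarrow> real) \<Rightarrow> bool"
  where "relaxed_run V \<eta> I M x i lam \<longleftrightarrow>
    (\<forall>n<M. i n \<in> I \<and> lam n \<in> {\<eta>..2 - \<eta>} \<and> x (Suc n) = relaxed_proj (V (i n)) (lam n) (x n))"

lemma relaxed_run_prefix: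
  assumes "relaxed_run V \<eta> I M x i lam" "L \<le> M"
  shows "relaxed_run V \<eta> (i ` {..<L}) L x i lam"
  using assms by (auto simp: relaxed_run_def)

lemma relaxed_run_initial:
  assumes "relaxed_run V \<eta> I M x i lam" "L \<le> M"
  shows "relaxed_run V \<eta> I L x i lam"
  using assms by (auto simp: relaxed_run_def)

lemma relaxed_run_shift:
  assumes "relaxed_run V \<eta> I (L + M) x i lam"
  shows "relaxed_run V \<eta> I M (\<lambda>n. x (L + n)) (\<lambda>n. i (L + n)) (\<lambda>n. lam (L + n))"
  using assms by (auto simp: relaxed_run_def)

text \<open>Only pairs consisting of an intersection and one further subspace enter, because indices
  are met one at a time.\<close>

locale regular_family =
  fixes N :: nat and V :: "nat \<Rightarrow> 'a::{real_inner, complete_space} set" and \<kappa> \<eta> :: real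
  assumes closed_subspace: "\<And>j. j \<in> {1..N} \<Longrightarrow> closed_subspace (V j)"
    and \<kappa>_ge_2: "2 \<le> \<kappa>"
    and \<eta>: "0 < \<eta>" "\<eta> \<le> 1"
    and regular: "\<And>I j x. I \<subseteq> {1..N} \<Longrightarrow> j \<in> {1..N} \<Longrightarrow>
      infdist x (subspace_Inter V (insert j I))
        \<le> \<kappa> * max (infdist x (subspace_Inter V I)) (infdist x (V j))"
begin

abbreviation gap :: "nat set \<Rightarrow> 'a \<Rightarrow> real" where
  "gap I x \<equiv> infdist x (subspace_Inter V I)"

abbreviation step_dist :: "(nat \<Rightarrow> 'a) \<Rightarrow> (nat \<Rightarrow> nat) \<Rightarrow> nat \<Rightarrow> real" where
  "step_dist x i n \<equiv> infdist (x n) (V (i n))"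

abbreviation run where "run \<equiv> relaxed_run V \<eta>"

definition \<epsilon> :: real where "\<epsilon> = 1/2 * \<kappa> powi (- int N)"

definition \<beta> :: real where "\<beta> = sqrt (1 - \<eta> * (2 - \<eta>) * \<epsilon>\<^sup>2)"

lemma closed_subspace_gap: "I \<subseteq> {1..N} \<Longrightarrow> closed_subspace (subspace_Inter V I)"
  using closed_subspace by (intro closed_subspace_Inter) blast

lemma gap_mono:
  assumes "J \<subseteq> I" "I \<subseteq> {1..N}"
  shows "gap J x \<le> gap I x"
proof (rule infdist_mono)
  show "subspace_Inter V I \<subseteq> subspace_Inter V J" using assms by (auto simp: subspace_Inter_def)
  show "subspace_Inter V I \<noteq> {}"
    using closed_subspace.zero_in[OF closed_subspace_gap[OF assms(2)]] by blast
qed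

lemma infdist_le_gap:
  assumes "j \<in> I" "I \<subseteq> {1..N}"
  shows "infdist x (V j) \<le> gap I x"
  using gap_mono[of "{j}" I] assms by (simp add: subspace_Inter_def)

lemma \<eta>_damping_bounds: "0 < \<eta> * (2 - \<eta>)" "\<eta> * (2 - \<eta>) \<le> 1"
proof -
  show "0 < \<eta> * (2 - \<eta>)" using \<eta> by simp
  have "1 - \<eta> * (2 - \<eta>) = (1 - \<eta>)\<^sup>2" by (simp add: power2_eq_square algebra_simps)
  then show "\<eta> * (2 - \<eta>) \<le> 1" by (metis diff_ge_0_iff_ge zero_le_power2)
qed

lemma gap_step:
  assumes "run J M x i lam" "n < M" "J \<subseteq> I" "I \<subseteq> {1..N}"
  shows "(gap I (x (Suc n)))\<^sup>2 = (gap I (x n))\<^sup>2 - lam n * (2 - lam n) * (step_dist x i n)\<^sup>2"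
proof -
  have "i n \<in> I" and step: "x (Suc n) = relaxed_proj (V (i n)) (lam n) (x n)"
    using assms by (auto simp: relaxed_run_def)
  moreover have "closed_subspace (V (i n))" using closed_subspace \<open>i n \<in> I\<close> assms(4) by blast
  moreover have "subspace_Inter V I \<subseteq> V (i n)" using \<open>i n \<in> I\<close> by (auto simp: subspace_Inter_def)
  ultimately show ?thesis
    using infdist_relaxed_proj[OF closed_subspace_gap[OF assms(4)]] by metis
qed

lemma gap_step_le:
  assumes "run I M x i lam" "n < M" "I \<subseteq> {1..N}"
  shows "(gap I (x (Suc n)))\<^sup>2 \<le> (gap I (x n))\<^sup>2 - \<eta> * (2 - \<eta>) * (step_dist x i n)\<^sup>2"
proof -
  have l: "\<eta> \<le> lam n" "lam n \<le> 2 - \<eta>" using assms by (auto simp: relaxed_run_def)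
  have "lam n * (2 - lam n) - \<eta> * (2 - \<eta>) = (lam n - \<eta>) * (2 - \<eta> - lam n)"
    by (simp add: algebra_simps)
  moreover have "0 \<le> (lam n - \<eta>) * (2 - \<eta> - lam n)" using l by simp
  ultimately have "\<eta> * (2 - \<eta>) \<le> lam n * (2 - lam n)" by linarith
  then have "\<eta> * (2 - \<eta>) * (step_dist x i n)\<^sup>2 \<le> lam n * (2 - lam n) * (step_dist x i n)\<^sup>2"
    by (rule mult_right_mono) simp
  then show ?thesis using gap_step[OF assms(1,2) order_refl assms(3)] by linarith
qed

lemma gap_antimono_time:
  assumes "run I M x i lam" "I \<subseteq> {1..N}" "m \<le> n" "n \<le> M"
  shows "gap I (x n) \<le> gap I (x m)"
  using assms(3,4)
proof (induction n rule: dec_induct)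
  case (step n)
  have "0 \<le> \<eta> * (2 - \<eta>) * (step_dist x i n)\<^sup>2"
    using \<eta> by simp
  then have "(gap I (x (Suc n)))\<^sup>2 \<le> (gap I (x n))\<^sup>2"
    using gap_step_le[OF assms(1) _ assms(2), of n] step.prems by linarith
  then have "gap I (x (Suc n)) \<le> gap I (x n)" by (rule power2_le_imp_le) (rule infdist_nonneg)
  then show ?case using step by simp
qed simp

text \<open>Estimates for the current point of a run can thus be carried back to its starting point,
  as long as the intersection involves all subspaces used in between.\<close>

lemma gap_decrease_independent:
  assumes "run J n x i lam" "J \<subseteq> I" "I \<subseteq> {1..N}"
  shows "(gap J (x 0))\<^sup>2 - (gap J (x n))\<^sup>2 = (gap I (x 0))\<^sup>2 - (gap I (x n))\<^sup>2"
  using assms(1)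
proof (induction n)
  case (Suc n)
  have "run J n x i lam" using relaxed_run_initial[OF Suc.prems] by simp
  note Suc.IH[OF this]
  moreover have "J \<subseteq> {1..N}" using assms(2,3) by blast
  ultimately show ?case
    using gap_step[OF Suc.prems lessI assms(2,3)] gap_step[OF Suc.prems lessI order_refl] by simp
qed simp

lemma \<epsilon>_pos: "0 < \<epsilon>"
  using \<kappa>_ge_2 by (simp add: \<epsilon>_def)

lemma \<epsilon>_le: "\<epsilon> \<le> 1/2"
proof -
  have "1 \<le> \<kappa> ^ N" using \<kappa>_ge_2 by (intro one_le_power) simp
  then show ?thesis by (simp add: \<epsilon>_def power_int_minus field_simps)
qed

lemma \<beta>_square: "\<beta>\<^sup>2 = 1 - \<eta> * (2 - \<eta>) * \<epsilon>\<^sup>2"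
  and \<beta>_pos: "0 < \<beta>" and \<beta>_less_1: "\<beta> < 1" and contraction_le_\<beta>: "1 - \<eta> \<le> \<beta>"
proof -
  have e: "0 < \<epsilon>\<^sup>2" "\<epsilon>\<^sup>2 < 1"
    using \<epsilon>_pos \<epsilon>_le power_strict_mono[of \<epsilon> 1 2] by auto
  define s where "s = \<eta> * (2 - \<eta>)"
  have s: "0 < s" "s \<le> 1" using \<eta>_damping_bounds by (auto simp: s_def)
  have le: "0 < s * \<epsilon>\<^sup>2" "s * \<epsilon>\<^sup>2 \<le> s"
    using e s mult_left_le[of "\<epsilon>\<^sup>2" s] by auto
  moreover have "s * \<epsilon>\<^sup>2 < 1"
    using e s mult_left_le_one_le[of "\<epsilon>\<^sup>2" s] by linarith
  ultimately show b: "\<beta>\<^sup>2 = 1 - \<eta> * (2 - \<eta>) * \<epsilon>\<^sup>2" "0 < \<beta>" "\<beta> < 1"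
    by (auto simp: \<beta>_def s_def[symmetric])
  have "(1 - \<eta>)\<^sup>2 = 1 - \<eta> * (2 - \<eta>)" by (simp add: power2_eq_square algebra_simps)
  then have "(1 - \<eta>)\<^sup>2 \<le> \<beta>\<^sup>2" using le b by (simp add: s_def)
  then show "1 - \<eta> \<le> \<beta>" using b by (intro power2_le_imp_le[of "1 - \<eta>"]) auto
qed

text \<open>The factors \<open>c\<^sub>k = 2 \<kappa>\<^bsup>2k\<^esup> - 1\<close> satisfy \<open>\<kappa>\<^sup>2 c\<^sub>k + 1 \<le> c\<^sub>k\<^sub>+\<^sub>1\<close>:
  the factor \<open>\<kappa>\<^sup>2\<close> is the price of intersecting with the new subspace, at the moment it is first
  used, and the \<open>1\<close> is the price of returning from that moment to time \<open>0\<close>. They are at least \<open>1\<close>, so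
  that they also dominate the bound \<open>e\<^sup>2\<close> for the squared distance to the new subspace.\<close>

lemma gap_of_visited:
  assumes run: "run I M x i lam" and I: "I \<subseteq> {1..N}"
    and small: "\<And>n. n < M \<Longrightarrow> step_dist x i n \<le> e"
    and decrease: "(gap I (x 0))\<^sup>2 - (gap I (x M))\<^sup>2 \<le> e\<^sup>2"
    and e: "0 \<le> e" and "n \<le> M"
  shows "(gap (i ` {..<n}) (x 0))\<^sup>2 \<le> (2 * \<kappa>\<^sup>2 ^ card (i ` {..<n}) - 1) * e\<^sup>2"
  using \<open>n \<le> M\<close>
proof (induction n)
  case 0
  then show ?case by (simp add: subspace_Inter_def)
next
  case (Suc n)
  define J where "J = i ` {..<n}"
  define c where "c = 2 * \<kappa>\<^sup>2 ^ card J - 1"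
  have IH: "(gap J (x 0))\<^sup>2 \<le> c * e\<^sup>2" using Suc by (simp add: J_def c_def)
  have J: "J \<subseteq> I" and j: "i n \<in> I" using run Suc.prems by (auto simp: relaxed_run_def J_def)
  have new: "i ` {..<Suc n} = insert (i n) J" by (auto simp: J_def lessThan_Suc)
  show ?case
  proof (cases "i n \<in> J")
    case True
    then show ?thesis using IH by (simp add: new insert_absorb c_def)
  next
    case False
    have \<kappa>2: "4 \<le> \<kappa>\<^sup>2" using power_mono[OF \<kappa>_ge_2, of 2] by simp
    then have "1 \<le> \<kappa>\<^sup>2 ^ card J" by (intro one_le_power[of "\<kappa>\<^sup>2"]) linarith
    then have c1: "1 \<le> c" by (simp add: c_def)
    have runJ: "run J n x i lam" unfolding J_def
      using relaxed_run_prefix[OF run] Suc.prems by simp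
    then have "gap J (x n) \<le> gap J (x 0)" using gap_antimono_time J I by blast
    then have "(gap J (x n))\<^sup>2 \<le> (gap J (x 0))\<^sup>2" by (intro power_mono infdist_nonneg)
    then have "(gap J (x n))\<^sup>2 \<le> c * e\<^sup>2" using IH by linarith
    moreover have "(step_dist x i n)\<^sup>2 \<le> c * e\<^sup>2"
    proof -
      have "(step_dist x i n)\<^sup>2 \<le> e\<^sup>2"
        using small[of n] Suc.prems by (intro power_mono infdist_nonneg) auto
      also have "\<dots> \<le> c * e\<^sup>2" using mult_right_mono[OF c1, of "e\<^sup>2"] by simp
      finally show ?thesis .
    qed
    ultimately have "(max (gap J (x n)) (step_dist x i n))\<^sup>2 \<le> c * e\<^sup>2" by (simp add: max_def)
    moreover have "(gap (insert (i n) J) (x n))\<^sup>2 \<le> (\<kappa> * max (gap J (x n)) (step_dist x i n))\<^sup>2"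
    proof (intro power_mono infdist_nonneg regular)
      show "J \<subseteq> {1..N}" "i n \<in> {1..N}" using J j I by blast+
    qed
    ultimately have at_n: "(gap (insert (i n) J) (x n))\<^sup>2 \<le> \<kappa>\<^sup>2 * (c * e\<^sup>2)"
      using mult_left_mono[of "(max (gap J (x n)) (step_dist x i n))\<^sup>2" "c * e\<^sup>2" "\<kappa>\<^sup>2"]
      by (simp add: power_mult_distrib)
    have runJ': "run (insert (i n) J) n x i lam" using runJ by (auto simp: relaxed_run_def)
    have "(gap (insert (i n) J) (x 0))\<^sup>2 - (gap (insert (i n) J) (x n))\<^sup>2
        = (gap I (x 0))\<^sup>2 - (gap I (x n))\<^sup>2"
      using gap_decrease_independent[OF runJ' _ I] J j by simp
    also have "\<dots> \<le> (gap I (x 0))\<^sup>2 - (gap I (x M))\<^sup>2"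
      using gap_antimono_time[OF run I, of n M] Suc.prems
      by (intro diff_left_mono power_mono infdist_nonneg) auto
    also note decrease
    finally have "(gap (insert (i n) J) (x 0))\<^sup>2 \<le> \<kappa>\<^sup>2 * (c * e\<^sup>2) + e\<^sup>2" using at_n by linarith
    also have "\<dots> = (\<kappa>\<^sup>2 * c + 1) * e\<^sup>2" by (simp add: algebra_simps)
    also have "\<dots> \<le> (2 * \<kappa>\<^sup>2 ^ Suc (card J) - 1) * e\<^sup>2"
      using \<kappa>2 by (intro mult_right_mono) (auto simp: c_def algebra_simps)
    finally show ?thesis using False by (simp add: new J_def)
  qed
qed

text \<open>Otherwise every step distance is at most \<open>\<epsilon> D\<close>, where \<open>D\<close> is the initial gap, since a
  larger one would by itself shrink the gap by the factor \<open>\<beta>\<close>. The preceding lemma then bounds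
  \<open>D\<^sup>2\<close> by \<open>2 \<kappa>\<^bsup>2N\<^esup> \<epsilon>\<^sup>2 D\<^sup>2 = D\<^sup>2 / 2\<close>.\<close>

lemma full_run_contracts:
  assumes I: "I \<subseteq> {1..N}" and run: "run I L x i lam" and full: "i ` {..<L} = I"
  shows "gap I (x L) \<le> \<beta> * gap I (x 0)"
proof (rule ccontr)
  assume "\<not> ?thesis"
  then have gt: "\<beta> * gap I (x 0) < gap I (x L)" by simp
  define D where "D = gap I (x 0)"
  define e where "e = \<epsilon> * D"
  have D: "0 < D"
  proof (rule ccontr)
    assume "\<not> 0 < D"
    then have "D = 0" using infdist_nonneg[of "x 0"] by (simp add: D_def order_less_le)
    then show False
      using gt gap_antimono_time[OF run I, of 0 L] by (simp add: D_def)
  qed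
  have "(\<beta> * D)\<^sup>2 < (gap I (x L))\<^sup>2"
    using gt \<beta>_pos D by (intro power_strict_mono) (auto simp: D_def)
  then have drop: "D\<^sup>2 - (gap I (x L))\<^sup>2 < \<eta> * (2 - \<eta>) * e\<^sup>2"
    by (simp add: power_mult_distrib \<beta>_square e_def algebra_simps)
  have "(gap (i ` {..<L}) (x 0))\<^sup>2 \<le> (2 * \<kappa>\<^sup>2 ^ card (i ` {..<L}) - 1) * e\<^sup>2"
  proof (rule gap_of_visited[OF run I])
    show "step_dist x i n \<le> e" if "n < L" for n
    proof -
      have "(gap I (x L))\<^sup>2 \<le> (gap I (x (Suc n)))\<^sup>2"
        using gap_antimono_time[OF run I, of "Suc n" L] that by (intro power_mono infdist_nonneg) auto
      also have "\<dots> \<le> (gap I (x n))\<^sup>2 - \<eta> * (2 - \<eta>) * (step_dist x i n)\<^sup>2"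
        by (rule gap_step_le[OF run that I])
      also have "(gap I (x n))\<^sup>2 \<le> D\<^sup>2"
        using gap_antimono_time[OF run I, of 0 n] that unfolding D_def
        by (intro power_mono infdist_nonneg) auto
      finally have "\<eta> * (2 - \<eta>) * (step_dist x i n)\<^sup>2 < \<eta> * (2 - \<eta>) * e\<^sup>2"
        using drop by linarith
      then have "(step_dist x i n)\<^sup>2 < e\<^sup>2" using \<eta>_damping_bounds by (simp add: mult_less_cancel_left)
      then show ?thesis by - (rule power2_le_imp_le, use D \<epsilon>_pos in \<open>simp_all add: e_def\<close>)
    qed
    have "\<eta> * (2 - \<eta>) * e\<^sup>2 \<le> e\<^sup>2"
      using \<eta>_damping_bounds by (intro mult_left_le_one_le) auto
    then show "(gap I (x 0))\<^sup>2 - (gap I (x L))\<^sup>2 \<le> e\<^sup>2" using drop by (simp add: D_def)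
    show "0 \<le> e" using D \<epsilon>_pos by (simp add: e_def)
  qed simp
  then have "D\<^sup>2 \<le> (2 * \<kappa>\<^sup>2 ^ card I - 1) * e\<^sup>2" by (simp add: full D_def)
  also have "\<dots> \<le> 2 * \<kappa>\<^sup>2 ^ N * e\<^sup>2"
  proof (rule mult_right_mono)
    have "card I \<le> N" using card_mono[OF _ I] by simp
    then have "\<kappa>\<^sup>2 ^ card I \<le> \<kappa>\<^sup>2 ^ N"
      using \<kappa>_ge_2 by (intro power_increasing) (auto intro: one_le_power)
    then show "2 * \<kappa>\<^sup>2 ^ card I - 1 \<le> 2 * \<kappa>\<^sup>2 ^ N" by simp
  qed simp
  also have "\<dots> = D\<^sup>2 / 2"
    using \<kappa>_ge_2
    by (simp add: e_def \<epsilon>_def power_int_minus field_simps flip: power_mult power_mult_distrib)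
  finally show False using D by simp
qed

lemma single_step_contracts:
  assumes I: "{j} \<subseteq> {1..N}" and run: "run {j} L x i lam" and full: "i ` {..<L} = {j}"
  shows "gap {j} (x L) \<le> (1 - \<eta>) * gap {j} (x 0)"
proof -
  have L: "0 < L" using full by (cases L) auto
  then have "i 0 = j" using run by (auto simp: relaxed_run_def)
  have "(gap {j} (x (Suc 0)))\<^sup>2 \<le> (gap {j} (x 0))\<^sup>2 - \<eta> * (2 - \<eta>) * (gap {j} (x 0))\<^sup>2"
    using gap_step_le[OF run L I] \<open>i 0 = j\<close> by (simp add: subspace_Inter_def)
  also have "\<dots> = ((1 - \<eta>) * gap {j} (x 0))\<^sup>2" by (simp add: power2_eq_square algebra_simps)
  finally have "gap {j} (x (Suc 0)) \<le> (1 - \<eta>) * gap {j} (x 0)"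
    by (rule power2_le_imp_le) (use \<eta> in \<open>simp add: infdist_nonneg\<close>)
  then show ?thesis using gap_antimono_time[OF run I, of "Suc 0" L] L by simp
qed

section \<open>Moments of the step distances\<close>

text \<open>The block decomposition, with the contraction factor \<open>\<rho>\<close> left open so that it serves both
  for a single subspace and for several. The induction splits off one block, of length \<open>L\<close>: its
  first \<open>L - 1\<close> steps use a proper subset of \<open>I\<close>, its last step costs at most the initial gap,
  and the remaining run starts with a gap smaller by the factor \<open>\<rho>\<close>.\<close>

lemma power_sum_recursion:
  assumes \<gamma>: "0 < \<gamma>" and \<rho>: "0 \<le> \<rho>" "\<rho> < 1" and F: "0 \<le> F" and I: "I \<subseteq> {1..N}" "I \<noteq> {}"
    and contracts: "\<And>L x i lam. run I L x i lam \<Longrightarrow> i ` {..<L} = I \<Longrightarrow> gap I (x L) \<le> \<rho> * gap I (x 0)"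
    and proper: "\<And>J M x i lam. J \<subset> I \<Longrightarrow> run J M x i lam \<Longrightarrow>
      (\<Sum>n<M. step_dist x i n powr \<gamma>) \<le> F * gap J (x 0) powr \<gamma>"
    and run: "run I M x i lam"
  shows "(\<Sum>n<M. step_dist x i n powr \<gamma>) \<le> (F + 1) / (1 - \<rho> powr \<gamma>) * gap I (x 0) powr \<gamma>"
  using run
proof (induction M arbitrary: x i lam rule: less_induct)
  case (less M)
  define r where "r = \<rho> powr \<gamma>"
  have r: "0 \<le> r" "r < 1" using powr_less_mono2[OF \<gamma> \<rho>] by (auto simp: r_def)
  define C where "C = (F + 1) / (1 - r)"
  define g where "g = gap I (x 0) powr \<gamma>"
  have C: "F \<le> C" "0 \<le> C" "F + 1 + C * r = C" using r F by (auto simp: C_def field_simps)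
  have g: "0 \<le> g" by (simp add: g_def)
  have below: "(\<Sum>n<L. step_dist x i n powr \<gamma>) \<le> F * g" if "L \<le> M" "i ` {..<L} \<noteq> I" for L
  proof -
    have sub: "i ` {..<L} \<subset> I" using that less.prems by (auto simp: relaxed_run_def)
    have "(\<Sum>n<L. step_dist x i n powr \<gamma>) \<le> F * gap (i ` {..<L}) (x 0) powr \<gamma>"
      using proper[OF sub relaxed_run_prefix[OF less.prems that(1)]] .
    also have "\<dots> \<le> F * g" unfolding g_def
      using F \<gamma> gap_mono[of "i ` {..<L}" I "x 0"] sub I
      by (intro mult_left_mono powr_mono2) (auto simp: infdist_nonneg)
    finally show ?thesis .
  qed
  have "(\<Sum>n<M. step_dist x i n powr \<gamma>) \<le> C * g"
  proof (cases "i ` {..<M} = I")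
    case False
    then show ?thesis using below[of M] mult_right_mono[OF C(1) g] by simp
  next
    case True
    define L where "L = (LEAST L. i ` {..<L} = I)"
    have L: "i ` {..<L} = I" "L \<le> M"
      unfolding L_def
      using LeastI[of "\<lambda>L. i ` {..<L} = I", OF True] Least_le[of "\<lambda>L. i ` {..<L} = I", OF True] by blast+
    then obtain K where K: "L = Suc K" using I(2) by (cases L) auto
    have "i ` {..<K} \<noteq> I" using not_less_Least[of K "\<lambda>L. i ` {..<L} = I"] K by (simp add: L_def)
    then have first: "(\<Sum>n<K. step_dist x i n powr \<gamma>) \<le> F * g" using below K L by simp
    have last: "step_dist x i K powr \<gamma> \<le> g"
    proof -
      have "step_dist x i K \<le> gap I (x K)"
        using infdist_le_gap I(1) less.prems K L by (auto simp: relaxed_run_def)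
      also have "\<dots> \<le> gap I (x 0)" using gap_antimono_time[OF less.prems I(1), of 0 K] K L by simp
      finally show ?thesis using \<gamma> unfolding g_def by (intro powr_mono2) (auto simp: infdist_nonneg)
    qed
    have "(\<Sum>n<M - L. step_dist x i (L + n) powr \<gamma>) \<le> C * (gap I (x L) powr \<gamma>)"
      using less.IH[of "M - L" "\<lambda>n. x (L + n)" "\<lambda>n. i (L + n)" "\<lambda>n. lam (L + n)"]
        relaxed_run_shift[of V \<eta> I L "M - L" x i lam] less.prems K L
      by (simp add: C_def r_def)
    also have "gap I (x L) powr \<gamma> \<le> r * g"
    proof -
      have "gap I (x L) \<le> \<rho> * gap I (x 0)"
        using contracts[OF relaxed_run_initial[OF less.prems L(2)] L(1)] .
      then have "gap I (x L) powr \<gamma> \<le> (\<rho> * gap I (x 0)) powr \<gamma>"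
        using \<gamma> by (intro powr_mono2) (auto simp: infdist_nonneg)
      then show ?thesis using \<rho> by (simp add: powr_mult infdist_nonneg r_def g_def)
    qed
    finally have rest: "(\<Sum>n<M - L. step_dist x i (L + n) powr \<gamma>) \<le> C * (r * g)"
      using C(2) by (simp add: mult_left_mono)
    have "(\<Sum>n<M. step_dist x i n powr \<gamma>)
        = (\<Sum>n<L. step_dist x i n powr \<gamma>) + (\<Sum>n<M - L. step_dist x i (L + n) powr \<gamma>)"
      using L(2) sum.atLeastLessThan_concat[of 0 L M "\<lambda>n. step_dist x i n powr \<gamma>"]
        sum.shift_bounds_nat_ivl[of "\<lambda>n. step_dist x i n powr \<gamma>" 0 L "M - L"]
      by (simp add: atLeast0LessThan add.commute)
    also have "\<dots> \<le> (F * g + g) + C * (r * g)" using first last rest K by simp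
    also have "\<dots> = (F + 1 + C * r) * g" by (simp add: algebra_simps)
    finally show ?thesis by (simp only: C(3))
  qed
  then show ?case by (simp add: C_def g_def r_def)
qed

text \<open>The bounds \<open>F\<close> of the recursion are at least \<open>1\<close>, so \<open>F + 1 \<le> 2 F\<close>: each subspace
  after the first contributes a factor \<open>2 / (1 - \<beta> powr \<gamma>)\<close>.\<close>

lemma power_sum_bound:
  assumes \<gamma>: "0 < \<gamma>" and I: "I \<subseteq> {1..N}" "card I \<le> Suc m" and run: "run I M x i lam"
  shows "(\<Sum>n<M. step_dist x i n powr \<gamma>)
    \<le> (2 / (1 - \<beta> powr \<gamma>)) ^ m / (1 - (1 - \<eta>) powr \<gamma>) * gap I (x 0) powr \<gamma>"
  using I run
proof (induction m arbitrary: I M x i lam)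
  case 0
  have fin: "finite I" using 0(1) finite_subset by blast
  consider "I = {}" | j where "I = {j}"
    using 0(2) fin by (metis One_nat_def card_0_eq card_1_singletonE le_Suc_eq le_zero_eq)
  then show ?case
  proof cases
    case 1
    then have "M = 0" using 0(3) by (cases M) (auto simp: relaxed_run_def)
    have "(1 - \<eta>) powr \<gamma> \<le> 1" using \<eta> \<gamma> by (intro powr_le1) auto
    then show ?thesis using \<open>M = 0\<close> by simp
  next
    case 2
    have "(\<Sum>n<M. step_dist x i n powr \<gamma>) \<le> (0 + 1) / (1 - (1 - \<eta>) powr \<gamma>) * gap I (x 0) powr \<gamma>"
    proof (rule power_sum_recursion[OF \<gamma> _ _ _ 0(1) _ _ _ 0(3)])
      show "gap I (x L) \<le> (1 - \<eta>) * gap I (x 0)" if "run I L x i lam" "i ` {..<L} = I"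
        for L x i lam
        using single_step_contracts that 0(1) unfolding 2 by blast
      show "(\<Sum>n<M. step_dist x i n powr \<gamma>) \<le> 0 * gap J (x 0) powr \<gamma>"
        if "J \<subset> I" "run J M x i lam" for J M x i lam
      proof -
        have "J = {}" using that(1) 2 by auto
        then have "M = 0" using that(2) by (cases M) (auto simp: relaxed_run_def)
        then show ?thesis by simp
      qed
    qed (use \<eta> 2 in auto)
    then show ?thesis by simp
  qed
next
  case (Suc m)
  define q where "q = 1 / (1 - \<beta> powr \<gamma>)"
  define F where "F = (2 * q) ^ m / (1 - (1 - \<eta>) powr \<gamma>)"
  have b: "\<beta> powr \<gamma> < 1" using powr_less_mono2[OF \<gamma> _ \<beta>_less_1] \<beta>_pos by simp
  have e: "(1 - \<eta>) powr \<gamma> < 1" using powr_less_mono2[OF \<gamma>, of "1 - \<eta>" 1] \<eta> by simp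
  have q: "1 \<le> q" using b by (simp add: q_def)
  have "1 \<le> (2 * q) ^ m" using q by (intro one_le_power) simp
  moreover have "1 - (1 - \<eta>) powr \<gamma> \<le> 1" by simp
  ultimately have F: "1 \<le> F" using e unfolding F_def by (subst le_divide_eq_1_pos) linarith+
  have q2: "2 / (1 - \<beta> powr \<gamma>) = 2 * q" by (simp add: q_def)
  have grow: "F \<le> 2 * q * F" using q F mult_right_mono[of 1 "2 * q" F] by simp
  have result: "(2 / (1 - \<beta> powr \<gamma>)) ^ Suc m / (1 - (1 - \<eta>) powr \<gamma>) = 2 * q * F"
    unfolding q2 F_def by simp
  show ?case
  proof (cases "card I \<le> Suc m")
    case True
    then have "(\<Sum>n<M. step_dist x i n powr \<gamma>) \<le> F * gap I (x 0) powr \<gamma>"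
      using Suc.IH[OF Suc.prems(1) True Suc.prems(3)] by (simp add: F_def q2)
    also have "\<dots> \<le> 2 * q * F * gap I (x 0) powr \<gamma>" using grow by (intro mult_right_mono) auto
    finally show ?thesis unfolding result .
  next
    case False
    have fin: "finite I" using Suc.prems(1) finite_subset by blast
    have "(\<Sum>n<M. step_dist x i n powr \<gamma>) \<le> (F + 1) / (1 - \<beta> powr \<gamma>) * gap I (x 0) powr \<gamma>"
    proof (rule power_sum_recursion[OF \<gamma> _ \<beta>_less_1 _ Suc.prems(1) _ _ _ Suc.prems(3)])
      show "gap I (x L) \<le> \<beta> * gap I (x 0)" if "run I L x i lam" "i ` {..<L} = I" for L x i lam
        using full_run_contracts[OF Suc.prems(1) that] .
      show "(\<Sum>n<M. step_dist x i n powr \<gamma>) \<le> F * gap J (x 0) powr \<gamma>"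
        if "J \<subset> I" "run J M x i lam" for J M x i lam
      proof -
        have "card J \<le> Suc m" using psubset_card_mono[OF fin that(1)] Suc.prems(2) by simp
        then show ?thesis
          using Suc.IH[OF _ _ that(2)] that(1) Suc.prems(1) by (auto simp: F_def q2)
      qed
    qed (use \<beta>_pos F False in auto)
    also have "(F + 1) / (1 - \<beta> powr \<gamma>) = (F + 1) * q" by (simp add: q_def)
    also have "(F + 1) * q * gap I (x 0) powr \<gamma> \<le> 2 * q * F * gap I (x 0) powr \<gamma>"
      using q F by (intro mult_right_mono) auto
    finally show ?thesis unfolding result .
  qed
qed

end

section \<open>From moments to the number of large steps\<close>

lemma geometric_factor_le:
  fixes \<rho> \<gamma> :: real
  assumes "0 < \<rho>" "\<rho> < 1" "0 < \<gamma>"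
  shows "1 / (1 - \<rho> powr \<gamma>) \<le> 1 + 1 / (\<gamma> * (- ln \<rho>))"
proof -
  define y where "y = \<gamma> * (- ln \<rho>)"
  have y: "0 < y" using assms by (simp add: y_def mult_pos_neg)
  have "\<rho> powr \<gamma> = 1 / exp y" using assms by (simp add: powr_def y_def exp_minus field_simps)
  also have "\<dots> \<le> 1 / (1 + y)" using y exp_ge_add_one_self[of y] by (intro divide_left_mono) auto
  finally have "y / (1 + y) \<le> 1 - \<rho> powr \<gamma>" using y by (simp add: field_simps)
  moreover have "0 < y / (1 + y)" using y by simp
  ultimately have "1 / (1 - \<rho> powr \<gamma>) \<le> 1 / (y / (1 + y))" by (intro frac_le) auto
  also have "\<dots> = 1 + 1 / y" using y by (simp add: field_simps)
  finally show ?thesis by (simp add: y_def)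
qed

text \<open>With \<open>\<gamma> = N / (- ln \<tau>)\<close> one has \<open>\<tau> powr (- \<gamma>) = e\<^sup>N\<close>, and each geometric factor
  becomes a factor of the stated bound. For \<open>\<tau> = 1\<close> no exponent is distinguished, and any
  \<open>\<gamma>\<close> large enough will do; \<open>\<beta> powr \<gamma> = 1/3\<close> makes \<open>2 / (1 - \<beta> powr \<gamma>)\<close> equal to \<open>3\<close>.\<close>

lemma count_le_of_power_moments:
  fixes c \<tau> \<beta> \<rho> :: real
  assumes N: "1 \<le> N" and \<beta>: "0 < \<beta>" "\<beta> < 1" and \<rho>: "0 \<le> \<rho>" "\<rho> \<le> \<beta>" and \<tau>: "0 < \<tau>" "\<tau> \<le> 1"
    and moments: "\<And>\<gamma>. 0 < \<gamma> \<Longrightarrow>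
      c * \<tau> powr \<gamma> \<le> (2 / (1 - \<beta> powr \<gamma>)) ^ (N - 1) / (1 - \<rho> powr \<gamma>)"
  shows "c \<le> 3 ^ (N - 1) * exp 1 ^ N * (1 + ln \<tau> / (real N * ln \<beta>)) ^ (N - 1)
    * (if \<rho> = 0 then 1 else 1 + ln \<tau> / (real N * ln \<rho>))"
proof (cases "\<tau> = 1")
  case True
  define \<gamma> where "\<gamma> = ln (1/3) / ln \<beta>"
  have lb: "ln \<beta> < 0" using \<beta> by simp
  have "0 < \<gamma>" using lb by (simp add: \<gamma>_def divide_neg_neg)
  have b: "\<beta> powr \<gamma> = 1/3" using \<beta> lb by (simp add: powr_def \<gamma>_def)
  have "\<rho> powr \<gamma> \<le> 1/3" using powr_mono2[of \<gamma> \<rho> \<beta>] \<rho> \<open>0 < \<gamma>\<close> b by simp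
  then have last: "1 / (1 - \<rho> powr \<gamma>) \<le> 2" by (simp add: field_simps)
  have "c \<le> 3 ^ (N - 1) * (1 / (1 - \<rho> powr \<gamma>))"
    using moments[OF \<open>0 < \<gamma>\<close>] True b by simp
  also have "\<dots> \<le> 3 ^ (N - 1) * exp 1 ^ N"
  proof (rule mult_left_mono)
    have "(2::real) \<le> exp 1" using exp_ge_add_one_self[of 1] by simp
    also have "exp 1 \<le> (exp 1 :: real) ^ N" using N by (intro self_le_power) auto
    finally show "1 / (1 - \<rho> powr \<gamma>) \<le> exp 1 ^ N" using last by linarith
  qed simp
  finally show ?thesis using True by simp
next
  case False
  define \<gamma> where "\<gamma> = real N / (- ln \<tau>)"
  have lt: "ln \<tau> < 0" using \<tau> False by simp
  have \<gamma>: "0 < \<gamma>" using lt N by (simp add: \<gamma>_def divide_pos_neg)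
  have factor: "1 / (1 - s powr \<gamma>) \<le> 1 + ln \<tau> / (real N * ln s)" if "0 < s" "s < 1" for s
  proof -
    have "1 / (\<gamma> * (- ln s)) = ln \<tau> / (real N * ln s)" using lt N by (simp add: \<gamma>_def)
    then show ?thesis using geometric_factor_le[OF that \<gamma>] by simp
  qed
  have pos: "0 < 1 - s powr \<gamma>" if "0 \<le> s" "s < 1" for s
    using powr_less_mono2[OF \<gamma> that] by simp
  have "\<tau> powr \<gamma> * exp 1 ^ N = 1"
    using \<tau> lt by (simp add: powr_def \<gamma>_def exp_minus flip: exp_of_nat_mult)
  then have "c = (c * \<tau> powr \<gamma>) * exp 1 ^ N" by (simp add: mult.assoc)
  also have "\<dots> \<le> ((2 / (1 - \<beta> powr \<gamma>)) ^ (N - 1) / (1 - \<rho> powr \<gamma>)) * exp 1 ^ N"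
    by (intro mult_right_mono moments \<gamma>) simp
  also have "\<dots> = (2 * (1 / (1 - \<beta> powr \<gamma>))) ^ (N - 1) * exp 1 ^ N * (1 / (1 - \<rho> powr \<gamma>))"
    by simp
  also have "\<dots> \<le> (3 * (1 + ln \<tau> / (real N * ln \<beta>))) ^ (N - 1) * exp 1 ^ N
      * (if \<rho> = 0 then 1 else 1 + ln \<tau> / (real N * ln \<rho>))"
  proof (intro mult_mono power_mono)
    show "1 / (1 - \<beta> powr \<gamma>) \<le> 1 + ln \<tau> / (real N * ln \<beta>)" using factor \<beta> by blast
    show "1 / (1 - \<rho> powr \<gamma>) \<le> (if \<rho> = 0 then 1 else 1 + ln \<tau> / (real N * ln \<rho>))"
      using factor[of \<rho>] \<rho> \<beta> by auto
    have "0 \<le> ln \<tau> / (real N * ln \<beta>)"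
      using lt \<beta> N by (intro divide_nonpos_neg) (auto simp: mult_pos_neg)
    then show "0 \<le> (3 * (1 + ln \<tau> / (real N * ln \<beta>))) ^ (N - 1)"
      "0 \<le> (3 * (1 + ln \<tau> / (real N * ln \<beta>))) ^ (N - 1) * exp 1 ^ N" by simp_all
  qed (use pos[of \<beta>] pos[of \<rho>] \<beta> \<rho> in auto)
  finally show ?thesis by (simp only: power_mult_distrib mult_ac)
qed

text \<open>As \<open>\<rho> \<le> \<beta>\<close>, the last factor is at most the other ones, and \<open>3\<^bsup>N-1\<^esup> e\<^sup>N < 9\<^sup>N\<close>
  by \<open>e \<le> 3\<close>.\<close>

lemma mixed_bound_less:
  fixes \<tau> \<beta> \<rho> :: real
  assumes N: "1 \<le> N" and \<beta>: "0 < \<beta>" "\<beta> < 1" and \<rho>: "0 \<le> \<rho>" "\<rho> \<le> \<beta>" and \<tau>: "0 < \<tau>" "\<tau> \<le> 1"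
  shows "3 ^ (N - 1) * exp 1 ^ N * (1 + ln \<tau> / (real N * ln \<beta>)) ^ (N - 1)
    * (if \<rho> = 0 then 1 else 1 + ln \<tau> / (real N * ln \<rho>))
    < 9 ^ N * (1 + ln \<tau> / (real N * ln \<beta>)) ^ N"
proof -
  define A where "A = 1 + ln \<tau> / (real N * ln \<beta>)"
  define B where "B = (if \<rho> = 0 then 1 else 1 + ln \<tau> / (real N * ln \<rho>))"
  have lt: "ln \<tau> \<le> 0" and lb: "ln \<beta> < 0" using \<tau> \<beta> by auto
  have neg: "real N * ln \<beta> < 0" using N lb by (simp add: mult_pos_neg)
  have A: "1 \<le> A" using lt neg by (simp add: A_def divide_nonpos_neg)
  have B: "B \<le> A"
  proof (cases "\<rho> = 0")
    case False
    then have "ln \<rho> \<le> ln \<beta>" using \<rho> by simp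
    then have "ln \<tau> / (real N * ln \<rho>) \<le> ln \<tau> / (real N * ln \<beta>)"
      using lt lb neg N by (intro divide_left_mono_neg) (auto simp: mult_neg_neg mult_pos_neg)
    then show ?thesis using False by (simp add: A_def B_def)
  qed (use A in \<open>simp add: B_def\<close>)
  have "3 ^ (N - 1) * exp 1 ^ N * A ^ (N - 1) * B \<le> 3 ^ (N - 1) * exp 1 ^ N * A ^ (N - 1) * A"
    using A B by (intro mult_left_mono) auto
  also have "\<dots> = 3 ^ (N - 1) * exp 1 ^ N * A ^ N"
    using N by (cases N) auto
  also have "\<dots> < 9 ^ N * A ^ N"
  proof (rule mult_strict_right_mono)
    have "(3::real) ^ (N - 1) * exp 1 ^ N \<le> 3 ^ (N - 1) * 3 ^ N"
      by (intro mult_left_mono power_mono exp_le) auto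
    also have "\<dots> < 3 ^ N * 3 ^ N" using N by (intro mult_strict_right_mono power_strict_increasing) auto
    also have "\<dots> = 9 ^ N" by (simp flip: power_mult_distrib)
    finally show "(3::real) ^ (N - 1) * exp 1 ^ N < 9 ^ N" .
  qed (use A in simp)
  finally show ?thesis by (simp add: A_def B_def)
qed

context regular_family
begin

text \<open>Markov's inequality for the moments. It is proved for finite sets of large steps first, since
  the finiteness of the set of all large steps is itself a consequence, by \<open>\<gamma> = 1\<close>.\<close>

lemma
  assumes x0: "x 0 \<noteq> 0" and run: "\<And>M. run {1..N} M x i lam" and N: "1 \<le> N" and \<tau>: "0 < \<tau>"
  shows large_steps_finite: "finite (large_steps \<eta> x \<tau>)"
    and large_steps_moment: "0 < \<gamma> \<Longrightarrow> real (card (large_steps \<eta> x \<tau>)) * \<tau> powr \<gamma>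
      \<le> (2 / (1 - \<beta> powr \<gamma>)) ^ (N - 1) / (1 - (1 - \<eta>) powr \<gamma>)"
proof -
  have moment: "real (card S) * \<tau> powr \<gamma> \<le> (2 / (1 - \<beta> powr \<gamma>)) ^ (N - 1) / (1 - (1 - \<eta>) powr \<gamma>)"
    if S: "finite S" "S \<subseteq> large_steps \<eta> x \<tau>" and \<gamma>: "0 < \<gamma>" for S \<gamma>
  proof -
    define C where "C = (2 / (1 - \<beta> powr \<gamma>)) ^ (N - 1) / (1 - (1 - \<eta>) powr \<gamma>)"
    define d where "d = norm (x 0)"
    have d: "0 < d" using x0 by (simp add: d_def)
    obtain M where M: "S \<subseteq> {..<M}" using finite_nat_iff_bounded[of S] S(1) by blast
    have "real (card S) * \<tau> powr \<gamma> = (\<Sum>n\<in>S. \<tau> powr \<gamma>)" by simp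
    also have "\<dots> \<le> (\<Sum>n\<in>S. (step_dist x i n / d) powr \<gamma>)"
    proof (rule sum_mono)
      fix n assume "n \<in> S"
      have "i n \<in> {1..N}" and l: "lam n \<in> {\<eta>..2 - \<eta>}"
        and step: "x (Suc n) = relaxed_proj (V (i n)) (lam n) (x n)"
        using run[of "Suc n"] by (auto simp: relaxed_run_def)
      have "\<tau> \<le> norm (x (Suc n) - x n) / ((2 - \<eta>) * d)"
        using S \<open>n \<in> S\<close> by (auto simp: large_steps_def rel_step_def d_def)
      also have "\<dots> = \<bar>lam n\<bar> * step_dist x i n / ((2 - \<eta>) * d)"
        using norm_relaxed_step[OF closed_subspace] \<open>i n \<in> {1..N}\<close> step by simp
      also have "\<dots> \<le> (2 - \<eta>) * step_dist x i n / ((2 - \<eta>) * d)"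
        using l \<eta> d by (intro divide_right_mono mult_right_mono) (auto simp: infdist_nonneg)
      also have "\<dots> = step_dist x i n / d" using \<eta> by simp
      finally show "\<tau> powr \<gamma> \<le> (step_dist x i n / d) powr \<gamma>"
        using \<tau> \<gamma> by (intro powr_mono2) auto
    qed
    also have "\<dots> \<le> (\<Sum>n<M. (step_dist x i n / d) powr \<gamma>)" using M by (intro sum_mono2) auto
    also have "\<dots> = (\<Sum>n<M. step_dist x i n powr \<gamma>) / d powr \<gamma>"
      using d by (simp add: powr_divide infdist_nonneg sum_divide_distrib)
    also have "\<dots> \<le> C"
    proof -
      have C0: "0 \<le> C"
        using powr_less_mono2[OF \<gamma>, of \<beta> 1] powr_less_mono2[OF \<gamma>, of "1 - \<eta>" 1] \<beta>_pos \<beta>_less_1 \<eta>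
        by (simp add: C_def)
      have "0 \<in> subspace_Inter V {1..N}"
        using closed_subspace.zero_in[OF closed_subspace_gap[OF order_refl]] .
      then have "gap {1..N} (x 0) \<le> d"
        using infdist_le[of 0 "subspace_Inter V {1..N}" "x 0"] by (simp add: d_def)
      then have "gap {1..N} (x 0) powr \<gamma> \<le> d powr \<gamma>"
        using \<gamma> by (intro powr_mono2) (auto simp: infdist_nonneg)
      then have "C * gap {1..N} (x 0) powr \<gamma> \<le> C * d powr \<gamma>" using C0 by (rule mult_left_mono)
      moreover have "(\<Sum>n<M. step_dist x i n powr \<gamma>) \<le> C * gap {1..N} (x 0) powr \<gamma>"
        unfolding C_def using N by (intro power_sum_bound[OF \<gamma> order_refl _ run]) simp
      ultimately show ?thesis using d by (simp add: field_simps)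
    qed
    finally show ?thesis by (simp add: C_def)
  qed
  define C where "C = (2 / (1 - \<beta> powr 1)) ^ (N - 1) / (1 - (1 - \<eta>) powr 1)"
  have "card S \<le> nat \<lfloor>C / \<tau>\<rfloor>" if "S \<subseteq> large_steps \<eta> x \<tau>" "finite S" for S
  proof (rule le_nat_floor)
    have "real (card S) * \<tau> powr 1 \<le> C" unfolding C_def by (rule moment) (use that in auto)
    then show "real (card S) \<le> C / \<tau>" using \<tau> by (simp add: pos_le_divide_eq)
  qed
  then show fin: "finite (large_steps \<eta> x \<tau>)"
    by (rule finite_if_finite_subsets_card_bdd[THEN conjunct1])
  show "real (card (large_steps \<eta> x \<tau>)) * \<tau> powr \<gamma>
      \<le> (2 / (1 - \<beta> powr \<gamma>)) ^ (N - 1) / (1 - (1 - \<eta>) powr \<gamma>)" if "0 < \<gamma>"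
    using moment[OF fin order_refl that] .
qed

end

section \<open>The constants of an innately regular collection\<close>

lemma sin_angle_UNIV: "sin (subspace_angle (UNIV :: 'a::{real_inner, complete_space} set) UNIV) = 1"
proof -
  have U: "closed_subspace (UNIV :: 'a set)" by (simp add: closed_subspace_def)
  have "friedrichs_cosine (UNIV :: 'a set) UNIV \<le> 0"
    by (rule cosine_least[OF U U]) simp
  then have "friedrichs_cosine (UNIV :: 'a set) UNIV = 0"
    using cosine_nonneg[OF U U] by simp
  then show ?thesis by (simp add: subspace_angle_arccos)
qed

lemma kappa_star_ge:
  assumes "I \<subseteq> {1..N}" "J \<subseteq> {1..N}"
  shows "2 / sin (subspace_angle (subspace_Inter V I) (subspace_Inter V J)) \<le> kappa_star N V"
  unfolding kappa_star_def
  by (rule Max_ge) (use assms in \<open>auto intro!: image_eqI[of _ _ "(I, J)"]\<close>)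

text \<open>The value \<open>2\<close> comes from the pair \<open>I = J = {}\<close>, whose angle is \<open>\<pi>/2\<close>.\<close>

lemma kappa_star_ge_2:
  fixes V :: "nat \<Rightarrow> 'a::{real_inner, complete_space} set"
  shows "2 \<le> kappa_star N V"
  using kappa_star_ge[of "{}" N "{}" V] by (simp add: subspace_Inter_def sin_angle_UNIV)

lemma innately_regular_pair:
  assumes "innately_regular N V" "I \<subseteq> {1..N}" "j \<in> {1..N}"
    and closed_subspace: "\<And>k. k \<in> {1..N} \<Longrightarrow> closed_subspace (V k)"
  obtains k where "\<And>x. infdist x (subspace_Inter V (insert j I))
      \<le> k * max (infdist x (subspace_Inter V I)) (infdist x (V j))"
proof -
  have "regular_collection (insert j I) V" using assms by (simp add: innately_regular_def)
  then obtain k where k: "\<And>x. infdist x (subspace_Inter V (insert j I))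
      \<le> k * (MAX l\<in>insert j I. infdist x (V l))"
    unfolding regular_collection_def subspace_Inter_def by blast
  have fin: "finite (insert j I)" using assms(2) finite_subset by blast
  have "infdist x (subspace_Inter V (insert j I))
      \<le> max k 0 * max (infdist x (subspace_Inter V I)) (infdist x (V j))" for x
  proof -
    have "closed_subspace (subspace_Inter V I)"
      using closed_subspace assms(2) by (intro closed_subspace_Inter) blast
    then have ne: "subspace_Inter V I \<noteq> {}" using closed_subspace.zero_in by blast
    have "infdist x (V l) \<le> max (infdist x (subspace_Inter V I)) (infdist x (V j))"
      if "l \<in> insert j I" for l
    proof (cases "l = j")
      case False
      then have "subspace_Inter V I \<subseteq> V l" using that by (auto simp: subspace_Inter_def)
      from infdist_mono[OF this ne] show ?thesis by (simp add: le_max_iff_disj)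
    qed simp
    then have "(MAX l\<in>insert j I. infdist x (V l)) \<le> max (infdist x (subspace_Inter V I)) (infdist x (V j))"
      using fin by (intro Max.boundedI) auto
    moreover have "0 \<le> (MAX l\<in>insert j I. infdist x (V l))"
      by (rule order_trans[OF infdist_nonneg[of x "V j"] Max_ge]) (use fin in auto)
    ultimately have "k * (MAX l\<in>insert j I. infdist x (V l))
        \<le> max k 0 * max (infdist x (subspace_Inter V I)) (infdist x (V j))"
      by (intro mult_mono) auto
    then show ?thesis using k[of x] by linarith
  qed
  then show thesis by (rule that)
qed

lemma regular_family_kappa_star:
  fixes V :: "nat \<Rightarrow> 'a::{real_inner, complete_space} set"
  assumes closed_subspace: "\<And>j. j \<in> {1..N} \<Longrightarrow> closed_subspace (V j)"
    and innate: "innately_regular N V" and \<eta>: "0 < \<eta>" "\<eta> \<le> 1"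
  shows "regular_family N V (kappa_star N V) \<eta>"
proof (rule regular_family.intro)
  fix I j x assume I: "I \<subseteq> {1..N}" and j: "j \<in> {1..N}"
  let ?s = "sin (subspace_angle (subspace_Inter V I) (V j))"
  have VI: "closed_subspace (subspace_Inter V I)"
    using closed_subspace I by (intro closed_subspace_Inter) blast
  have inter: "subspace_Inter V (insert j I) = subspace_Inter V I \<inter> V j"
    by (auto simp: subspace_Inter_def)
  obtain k where "\<And>x. infdist x (subspace_Inter V (insert j I))
      \<le> k * max (infdist x (subspace_Inter V I)) (infdist x (V j))"
    using innately_regular_pair[OF innate I j closed_subspace] by blast
  then have s: "0 < ?s"
    using sin_angle_pos_of_regular[OF VI closed_subspace[OF j]] unfolding inter by blast
  have "infdist x (subspace_Inter V (insert j I))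
      \<le> 2 / ?s * max (infdist x (subspace_Inter V I)) (infdist x (V j))"
    unfolding inter by (rule regular_of_sin_angle_pos[OF VI closed_subspace[OF j] s])
  also have "\<dots> \<le> kappa_star N V * max (infdist x (subspace_Inter V I)) (infdist x (V j))"
  proof (rule mult_right_mono)
    show "2 / ?s \<le> kappa_star N V"
      using kappa_star_ge[OF I, of "{j}" V] j by (simp add: subspace_Inter_def)
  qed (simp add: le_max_iff_disj infdist_nonneg)
  finally show "infdist x (subspace_Inter V (insert j I))
      \<le> kappa_star N V * max (infdist x (subspace_Inter V I)) (infdist x (V j))" .
qed (use closed_subspace kappa_star_ge_2 \<eta> in auto)

theorem proposition5p1:
  fixes N :: nat
    and V :: "nat \<Rightarrow> 'a::{real_inner, complete_space} set"
    and \<eta> :: real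
    and x :: "nat \<Rightarrow> 'a"
    and i :: "nat \<Rightarrow> nat"
    and lam :: "nat \<Rightarrow> real"
    and \<tau> :: real
  assumes "N \<ge> 1"
    and "\<And>j. j \<in> {1..N} \<Longrightarrow> subspace (V j)"
    and "\<And>j. j \<in> {1..N} \<Longrightarrow> closed (V j)"
    and "innately_regular N V"
    and "\<eta> \<in> {0<..1}"
    and "x 0 \<noteq> 0"
    and "\<And>n. i n \<in> {1..N}"
    and "\<And>n. lam n \<in> {\<eta>..2 - \<eta>}"
    and "\<And>n. x (Suc n) = relaxed_proj (V (i n)) (lam n) (x n)"
    and "\<tau> \<in> {0<..1}"
  shows "finite (large_steps \<eta> x \<tau>)
    \<and> real (card (large_steps \<eta> x \<tau>))
        \<le> 3 ^ (N - 1) * exp 1 ^ N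
           * (1 + ln \<tau> / (real N * ln (beta_star N V \<eta>))) ^ (N - 1)
           * (if \<eta> = 1 then 1 else 1 + ln \<tau> / (real N * ln (1 - \<eta>)))
    \<and> real (card (large_steps \<eta> x \<tau>))
        < 9 ^ N * (1 + ln \<tau> / (real N * ln (beta_star N V \<eta>))) ^ N"
proof -
  interpret regular_family N V "kappa_star N V" \<eta>
    using assms(2-5) by (intro regular_family_kappa_star) (auto simp: closed_subspace_def)
  have \<beta>: "\<beta> = beta_star N V \<eta>" by (simp add: \<beta>_def beta_star_def \<epsilon>_def eps_star_def)
  have \<tau>: "0 < \<tau>" "\<tau> \<le> 1" using assms(10) by auto
  have run: "run {1..N} M x i lam" for M using assms(7-9) unfolding relaxed_run_def by blast
  have \<eta>0: "0 \<le> 1 - \<eta>" using \<eta> by simp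
  have "real (card (large_steps \<eta> x \<tau>)) \<le> 3 ^ (N - 1) * exp 1 ^ N
      * (1 + ln \<tau> / (real N * ln \<beta>)) ^ (N - 1)
      * (if 1 - \<eta> = 0 then 1 else 1 + ln \<tau> / (real N * ln (1 - \<eta>)))"
    by (intro count_le_of_power_moments assms(1) \<beta>_pos \<beta>_less_1 contraction_le_\<beta> \<tau> \<eta>0
        large_steps_moment[OF assms(6) run])
  moreover note mixed_bound_less[OF assms(1) \<beta>_pos \<beta>_less_1 \<eta>0 contraction_le_\<beta> \<tau>]
  moreover have "finite (large_steps \<eta> x \<tau>)"
    by (rule large_steps_finite[OF assms(6) run assms(1) \<tau>(1)])
  ultimately show ?thesis by (auto simp: \<beta>[symmetric] simp del: One_nat_def)
qed

end
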